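(* Let $\mathcal D\subseteq\mathcal P$ be a convex set with $\mathsf P\in\mathcal D$, let $X=(X^1,\dots,X^d)$ with $X^i\in L^1_w(\mathcal D)$, and let $H\subseteq\mathbb R^d$ be a closed convex cone. Assume that $\mathsf E_{\mathsf P}X\ne0$, that $G=\mathrm{cl}\{\mathsf E_{\mathsf Q}X:\mathsf Q\in\mathcal D\}\subset\mathbb R^d$ is strictly convex (its interior is nonempty and its border contains no interval), and that $0$ belongs to the relative interior of $G+H^*$, where $H^*=\{x\in\mathbb R^d:\langle h,x\rangle\ge0\ \forall h\in H\}$. Let $R_*=\sup_{h\in H}\mathrm{RAROC}(\langle h,X\rangle)$. If $h\in H$ and $$\mathrm{RAROC}^c\Bigl(h^1X^1;\sum_{i=1}^dh^iX^i\Bigr)=\dots=\mathrm{RAROC}^c\Bigl(h^dX^d;\sum_{i=1}^dh^iX^i\Bigr),\qquad( * )$$ then $h\in\mathop{\rm argmax}_{g\in H}\mathrm{RAROC}(\langle g,X\rangle)$ and all the elements of the equality $( * )$ are equal to $R_*$. Conversely, if $h$ is an inner point of $H$ and $h\in\mathop{\rm argmax}_{g\in H}\mathrm{RAROC}(\langle g,X\rangle)$, then $( * )$ is satisfied.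
   Context: $(\Omega,\mathcal F,\mathsf P)$ is a probability space, $L^0$ is the space of real random variables, and $\mathcal P$ is the set of probability measures absolutely continuous with respect to $\mathsf P$. $\mathsf E_{\mathsf Q}X=\mathsf E_{\mathsf Q}X^+-\mathsf E_{\mathsf Q}X^-$ with $\infty-\infty=-\infty$. $L^1_w(\mathcal D)=\{X\in L^0:\inf_{\mathsf Q\in\mathcal D}\mathsf E_{\mathsf Q}X>-\infty\text{ and }\inf_{\mathsf Q\in\mathcal D}\mathsf E_{\mathsf Q}(-X)>-\infty\}$. Put $u(X)=\inf_{\mathsf Q\in\mathcal D}\mathsf E_{\mathsf Q}X$, $\rho=-u$, and $$\mathrm{RAROC}(X)=\begin{cases}+\infty&\text{if }\mathsf E_{\mathsf P}X>0\text{ and }u(X)\ge0,\\ \mathsf E_{\mathsf P}X/\rho(X)&\text{otherwise,}\end{cases}$$ with $\frac00=0$, $\frac\infty\infty=0$. The utility contribution of $X$ to $Y$ (for $X,Y\in L^1_w(\mathcal D)$) is $u^c(X;Y)=\lim_{\varepsilon\downarrow0}\varepsilon^{-1}(u(Y+\varepsilon X)-u(Y))$, the risk contribution is $\rho^c(X;Y)=-u^c(X;Y)$, and the RAROC contribution of $X$ to $Y$ is $\mathrm{RAROC}^c(X;Y)=\mathsf E_{\mathsf P}X/\rho^c(X;Y)$, which is well defined when $\rho^c(X;Y)\neq0$.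
   Formalization: The first implication adds the needed assumption E_P⟨h,X⟩ ≥ 0 (it is false otherwise) and takes ( * ) to include that all ρ^c ≠ 0; the converse asserts equality among those RAROC contributions that are well defined (ρ^c ≠ 0). *)

theory Defs
  imports "HOL-Probability.Probability"
begin

text \<open>The probability measures on the measurable space of \<open>M\<close> that are absolutely continuous
  with respect to \<open>M\<close>.\<close>

definition ac_prob_measures :: "'a measure \<Rightarrow> 'a measure set" where
  "ac_prob_measures M = {Q. prob_space Q \<and> sets Q = sets M \<and> absolutely_continuous M Q}"

text \<open>The type of measures has no vector space structure, so mixtures are described by their values
  on measurable sets, which determine a measure.\<close>

definition convex_measures :: "'a measure \<Rightarrow> 'a measure set \<Rightarrow> bool" where
  "convex_measures M D \<longleftrightarrow>
    (\<forall>Q1\<in>D. \<forall>Q2\<in>D. \<forall>t\<in>{0..1::real}. \<exists>Q\<in>D. \<forall>A\<in>sets M.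
       measure Q A = (1 - t) * measure Q1 A + t * measure Q2 A)"

text \<open>\<open>E\<^sub>Q Y = E\<^sub>Q Y\<^sup>+ - E\<^sub>Q Y\<^sup>-\<close> with \<open>\<infinity> - \<infinity> = -\<infinity>\<close>, whereas \<open>\<infinity> - \<infinity> = \<infinity>\<close> in type ereal.
  The function ennreal maps negative numbers to 0 and so takes positive parts.\<close>

definition expect :: "'a measure \<Rightarrow> ('a \<Rightarrow> real) \<Rightarrow> ereal" where
  "expect Q Y =
    (if (\<integral>\<^sup>+\<omega>. ennreal (- Y \<omega>) \<partial>Q) = \<infinity> then - \<infinity>
     else enn2ereal (\<integral>\<^sup>+\<omega>. ennreal (Y \<omega>) \<partial>Q) - enn2ereal (\<integral>\<^sup>+\<omega>. ennreal (- Y \<omega>) \<partial>Q))"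

definition utility :: "'a measure set \<Rightarrow> ('a \<Rightarrow> real) \<Rightarrow> ereal" where
  "utility D Y = (INF Q\<in>D. expect Q Y)"

definition risk :: "'a measure set \<Rightarrow> ('a \<Rightarrow> real) \<Rightarrow> ereal" where
  "risk D Y = - utility D Y"

definition L1w :: "'a measure \<Rightarrow> 'a measure set \<Rightarrow> ('a \<Rightarrow> real) set" where
  "L1w M D = {Y \<in> borel_measurable M.
     utility D Y > - \<infinity> \<and> utility D (\<lambda>\<omega>. - Y \<omega>) > - \<infinity>}"

text \<open>Division in type ereal satisfies \<open>0 / 0 = 0\<close> and \<open>\<infinity> / \<infinity> = 0\<close>.\<close>

definition RAROC :: "'a measure \<Rightarrow> 'a measure set \<Rightarrow> ('a \<Rightarrow> real) \<Rightarrow> ereal" where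
  "RAROC M D Y =
    (if expect M Y > 0 \<and> utility D Y \<ge> 0 then \<infinity> else expect M Y / risk D Y)"

definition utility_contr :: "'a measure set \<Rightarrow> ('a \<Rightarrow> real) \<Rightarrow> ('a \<Rightarrow> real) \<Rightarrow> ereal" where
  "utility_contr D Y Z =
    Lim (at_right (0::real))
      (\<lambda>\<epsilon>. ereal (1 / \<epsilon>) * (utility D (\<lambda>\<omega>. Z \<omega> + \<epsilon> * Y \<omega>) - utility D Z))"

definition risk_contr :: "'a measure set \<Rightarrow> ('a \<Rightarrow> real) \<Rightarrow> ('a \<Rightarrow> real) \<Rightarrow> ereal" where
  "risk_contr D Y Z = - utility_contr D Y Z"

text \<open>Meaningful only if \<open>risk_contr D Y Z \<noteq> 0\<close>; this has to be required wherever the notion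
  is used, because division by 0 is total in type ereal.\<close>

definition RAROC_contr ::
  "'a measure \<Rightarrow> 'a measure set \<Rightarrow> ('a \<Rightarrow> real) \<Rightarrow> ('a \<Rightarrow> real) \<Rightarrow> ereal" where
  "RAROC_contr M D Y Z = expect M Y / risk_contr D Y Z"

definition component :: "real ^ 'n \<Rightarrow> ('n \<Rightarrow> 'a \<Rightarrow> real) \<Rightarrow> 'n \<Rightarrow> 'a \<Rightarrow> real" where
  "component h X i = (\<lambda>\<omega>. h $ i * X i \<omega>)"

definition portfolio :: "real ^ 'n::finite \<Rightarrow> ('n \<Rightarrow> 'a \<Rightarrow> real) \<Rightarrow> 'a \<Rightarrow> real" where
  "portfolio h X = (\<lambda>\<omega>. \<Sum>i\<in>UNIV. component h X i \<omega>)"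

text \<open>If all \<open>X i\<close> are in \<open>L1w M D\<close> and \<open>Q \<in> D\<close>, then the expectations below are finite, so
  real_of_ereal loses nothing.\<close>

definition expect_vec :: "'a measure \<Rightarrow> ('n::finite \<Rightarrow> 'a \<Rightarrow> real) \<Rightarrow> real ^ 'n" where
  "expect_vec Q X = (\<chi> i. real_of_ereal (expect Q (X i)))"

definition generator :: "'a measure set \<Rightarrow> ('n::finite \<Rightarrow> 'a \<Rightarrow> real) \<Rightarrow> (real ^ 'n) set" where
  "generator D X = closure {expect_vec Q X | Q. Q \<in> D}"

text \<open>Applied to \<open>generator D X\<close> with \<open>D\<close> convex, so convexity of the set is not part of the
  condition.\<close>

definition strictly_convex :: "'b::euclidean_space set \<Rightarrow> bool" where
  "strictly_convex S \<longleftrightarrow>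
    interior S \<noteq> {} \<and> (\<forall>a b. a \<noteq> b \<longrightarrow> \<not> closed_segment a b \<subseteq> frontier S)"

definition dual_cone :: "'b::euclidean_space set \<Rightarrow> 'b set" where
  "dual_cone H = {x. \<forall>h\<in>H. h \<bullet> x \<ge> 0}"

end

theory Submission
  imports Defs
begin

text \<open>On portfolios, \<open>utility\<close> is the support function \<open>m g = min {g \<bullet> x | x \<in> G}\<close> of the
  generator \<open>G\<close>, and \<open>m\<close> is negative on \<open>H - {0}\<close>. By strict convexity the minimum at \<open>h \<noteq> 0\<close> has a
  unique minimizer \<open>x\<close>, which is then the gradient of \<open>m\<close> at \<open>h\<close>, and the RAROC contributions are
  \<open>- E\<^sub>i / x\<^sub>i\<close>, where \<open>E\<close> is the vector of expectations under the reference measure. They all equal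
  \<open>R\<close> iff \<open>E = - R x\<close>. If this holds and \<open>R \<ge> 0\<close>, then \<open>g \<bullet> E = - R (g \<bullet> x) \<le> - R m g\<close>, so \<open>R\<close> bounds
  RAROC on \<open>H\<close> and is attained at \<open>h\<close>. Conversely, an inner maximizer \<open>h\<close> with value \<open>R\<close> maximizes
  \<open>g \<bullet> E + R m g\<close> locally, and the gradient \<open>E + R x\<close> of this function vanishes at \<open>h\<close>.\<close>

section \<open>Integrals under mixtures of measures\<close>

text \<open>Both sides are additive, positively homogeneous and continuous along increasing
  sequences in \<open>f\<close>, so agreement on indicators extends to all nonnegative measurable
  functions.\<close>

lemma nn_integral_mixture:
  assumes "prob_space Q1" "prob_space Q2" "prob_space Q"
    and sets: "sets Q1 = sets Q" "sets Q2 = sets Q"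
    and t: "0 \<le> t" "t \<le> 1"
    and mix: "\<And>A. A \<in> sets Q \<Longrightarrow> measure Q A = (1 - t) * measure Q1 A + t * measure Q2 A"
    and f: "f \<in> borel_measurable Q"
  shows "(\<integral>\<^sup>+ x. f x \<partial>Q) =
    ennreal (1 - t) * (\<integral>\<^sup>+ x. f x \<partial>Q1) + ennreal t * (\<integral>\<^sup>+ x. f x \<partial>Q2)"
proof -
  interpret Q1: prob_space Q1 by fact
  interpret Q2: prob_space Q2 by fact
  interpret Q: prob_space Q by fact
  note meas = measurable_cong_sets[OF sets(1) refl] measurable_cong_sets[OF sets(2) refl]
  have space: "space Q1 = space Q" "space Q2 = space Q"
    using sets sets_eq_imp_space_eq by blast+
  from f show ?thesis
  proof (induction rule: borel_measurable_induct)
    case (cong f g)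
    then have "(\<integral>\<^sup>+ x. f x \<partial>N) = (\<integral>\<^sup>+ x. g x \<partial>N)" if "space N = space Q" for N
      by (intro nn_integral_cong) (simp add: that)
    then show ?case
      using cong space by simp
  next
    case (set A)
    then show ?case
      using t by (simp add: sets Q.emeasure_eq_measure Q1.emeasure_eq_measure
          Q2.emeasure_eq_measure mix ennreal_mult ennreal_plus)
  next
    case (mult u c)
    then show ?case
      by (simp add: nn_integral_cmult meas algebra_simps)
  next
    case (add u v)
    then show ?case
      by (simp add: nn_integral_add meas algebra_simps)
  next
    case (seq U)
    \<comment> \<open>Stated as a limit, monotone convergence passes through sums and constant
      multiples; it is used for all three measures.\<close>
    have conv: "(\<lambda>i. \<integral>\<^sup>+ x. U i x \<partial>N) \<longlonglongrightarrow> (\<integral>\<^sup>+ x. (SUP i. U i) x \<partial>N)"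
      if "sets N = sets Q" for N
    proof -
      have "(\<integral>\<^sup>+ x. (SUP i. U i x) \<partial>N) = (SUP i. \<integral>\<^sup>+ x. U i x \<partial>N)"
        using seq by (intro nn_integral_monotone_convergence_SUP)
          (auto simp: measurable_cong_sets[OF that refl])
      moreover have "incseq (\<lambda>i. \<integral>\<^sup>+ x. U i x \<partial>N)"
        using \<open>incseq U\<close> by (auto simp: incseq_def le_fun_def intro!: nn_integral_mono)
      ultimately show ?thesis
        by (simp add: LIMSEQ_SUP image_image)
    qed
    have "(\<lambda>i. \<integral>\<^sup>+ x. U i x \<partial>Q) \<longlonglongrightarrow>
      ennreal (1 - t) * (\<integral>\<^sup>+ x. (SUP i. U i) x \<partial>Q1) + ennreal t * (\<integral>\<^sup>+ x. (SUP i. U i) x \<partial>Q2)"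
      unfolding seq.IH by (intro tendsto_add ennreal_tendsto_cmult conv sets) auto
    with conv[OF refl] show ?case
      by (rule LIMSEQ_unique)
  qed
qed

text \<open>Positive and negative parts mix separately, and integrability makes their integrals
  finite, so they can be subtracted as reals.\<close>

lemma integral_mixture:
  fixes f :: "'a \<Rightarrow> real"
  assumes P: "prob_space Q1" "prob_space Q2" "prob_space Q"
    and sets: "sets Q1 = sets Q" "sets Q2 = sets Q"
    and t: "0 \<le> t" "t \<le> 1"
    and mix: "\<And>A. A \<in> sets Q \<Longrightarrow> measure Q A = (1 - t) * measure Q1 A + t * measure Q2 A"
    and f: "integrable Q f" "integrable Q1 f" "integrable Q2 f"
  shows "integral\<^sup>L Q f = (1 - t) * integral\<^sup>L Q1 f + t * integral\<^sup>L Q2 f"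
proof -
  have mix': "enn2real (\<integral>\<^sup>+ x. ennreal (g x) \<partial>Q) =
      (1 - t) * enn2real (\<integral>\<^sup>+ x. ennreal (g x) \<partial>Q1) + t * enn2real (\<integral>\<^sup>+ x. ennreal (g x) \<partial>Q2)"
    if g: "integrable Q g" "integrable Q1 g" "integrable Q2 g" for g :: "'a \<Rightarrow> real"
  proof -
    have "(\<lambda>x. ennreal (g x)) \<in> borel_measurable Q"
      using g(1) by measurable
    note * = nn_integral_mixture[OF P sets t mix this]
    have "(\<integral>\<^sup>+ x. ennreal (g x) \<partial>Q1) < \<infinity>" "(\<integral>\<^sup>+ x. ennreal (g x) \<partial>Q2) < \<infinity>"
      using g by (auto simp: real_integrable_def less_top)
    then show ?thesis
      using t by (simp add: * enn2real_plus enn2real_mult ennreal_mult_less_top)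
  qed
  show ?thesis
    using mix'[of f] mix'[of "\<lambda>x. - f x"] f
    by (simp add: real_lebesgue_integral_def algebra_simps)
qed

lemma expect_eq_integral:
  assumes "integrable Q Y"
  shows "expect Q Y = ereal (integral\<^sup>L Q Y)"
proof -
  have "enn2ereal a - enn2ereal b = ereal (enn2real a - enn2real b)" if "a \<noteq> \<infinity>" "b \<noteq> \<infinity>" for a b
    using that by (cases a; cases b) (auto simp: enn2ereal_ennreal)
  then show ?thesis
    using assms unfolding expect_def real_lebesgue_integral_def[OF assms] real_integrable_def
    by auto
qed

text \<open>Since \<open>expect\<close> resolves \<infinity> - \<infinity> to -\<infinity>, a value
  above -\<infinity> makes the negative part integrable. Applied to \<open>Y\<close> and
  \<open>- Y\<close>, this covers both parts.\<close>

lemma L1w_integrable: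
  assumes "Y \<in> L1w M D" "Q \<in> D" "sets Q = sets M"
  shows "integrable Q Y"
proof -
  have "Y \<in> borel_measurable Q"
    using assms by (auto simp: L1w_def measurable_cong_sets[OF assms(3) refl])
  moreover have "expect Q Y > -\<infinity>" "expect Q (\<lambda>\<omega>. - Y \<omega>) > -\<infinity>"
    using assms INF_lower[of Q D "\<lambda>Q. expect Q Y"] INF_lower[of Q D "\<lambda>Q. expect Q (\<lambda>\<omega>. - Y \<omega>)"]
    by (auto simp: L1w_def utility_def)
  ultimately show ?thesis
    by (auto simp: real_integrable_def expect_def split: if_splits)
qed

section \<open>Minimizing linear functions over a compact set\<close>

text \<open>This is minus the support function of \<open>G\<close> at \<open>- h\<close>. The
  infimum is taken in the reals, so it is used for nonempty bounded \<open>G\<close>.\<close>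

definition min_inner :: "'b::euclidean_space set \<Rightarrow> 'b \<Rightarrow> real" where
  "min_inner G h = (INF x\<in>G. h \<bullet> x)"

lemma bdd_below_inner:
  fixes G :: "'b::euclidean_space set"
  assumes "bounded G"
  shows "bdd_below ((\<lambda>x. h \<bullet> x) ` G)"
  by (intro bounded_imp_bdd_below bounded_linear_image[OF assms] bounded_linear_inner_right)

lemma min_inner_le:
  assumes "bounded G" "x \<in> G"
  shows "min_inner G h \<le> h \<bullet> x"
  unfolding min_inner_def using assms by (intro cINF_lower bdd_below_inner)

lemma min_inner_attained:
  assumes "compact G" "G \<noteq> {}"
  obtains x where "x \<in> G" "min_inner G h = h \<bullet> x"
proof -
  obtain x where x: "x \<in> G" "\<And>y. y \<in> G \<Longrightarrow> h \<bullet> x \<le> h \<bullet> y"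
    using continuous_attains_inf[OF assms continuous_on_inner[OF continuous_on_const continuous_on_id]]
    by blast
  have "min_inner G h = h \<bullet> x"
    using x min_inner_le[OF compact_imp_bounded[OF assms(1)] x(1)]
    by (intro antisym) (auto simp: min_inner_def intro!: cINF_greatest assms)
  with x that show thesis by blast
qed

text \<open>A closed half-space containing \<open>K\<close> contains its closure. This lets the
  compact generator replace the set of expectation vectors.\<close>

lemma min_inner_closure:
  assumes "bounded K" "K \<noteq> {}"
  shows "min_inner (closure K) h = (INF x\<in>K. h \<bullet> x)"
proof (rule antisym)
  show "min_inner (closure K) h \<le> (INF x\<in>K. h \<bullet> x)"
    unfolding min_inner_def using assms closure_subset
    by (intro cINF_superset_mono bdd_below_inner) auto
  have "(INF x\<in>K. h \<bullet> x) \<le> h \<bullet> y" if "y \<in> closure K" for y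
  proof -
    have "closure K \<subseteq> {y. (INF x\<in>K. h \<bullet> x) \<le> h \<bullet> y}"
      using assms by (intro closure_minimal )
        (auto intro!: cINF_lower bdd_below_inner simp: closed_halfspace_ge)
    with that show ?thesis by blast
  qed
  then show "(INF x\<in>K. h \<bullet> x) \<le> min_inner (closure K) h"
    unfolding min_inner_def using assms by (intro cINF_greatest) auto
qed

text \<open>Minimizers lie on a supporting hyperplane, which misses the interior; two of them would
  span a segment in the frontier.\<close>

lemma strictly_convex_unique_min:
  assumes G: "compact G" "convex G" "strictly_convex G" and "h \<noteq> 0"
  obtains x where "x \<in> G" "min_inner G h = h \<bullet> x" "\<And>y. y \<in> G \<Longrightarrow> y \<noteq> x \<Longrightarrow> h \<bullet> x < h \<bullet> y"
proof -
  have "G \<noteq> {}"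
    using G(3) by (auto simp: strictly_convex_def)
  then obtain x where x: "x \<in> G" "min_inner G h = h \<bullet> x"
    using min_inner_attained[OF G(1)] by metis
  have le: "h \<bullet> x \<le> h \<bullet> y" if "y \<in> G" for y
    using min_inner_le[OF compact_imp_bounded[OF G(1)] that] x(2) by metis
  have "h \<bullet> x < h \<bullet> y" if y: "y \<in> G" "y \<noteq> x" for y
  proof (rule ccontr)
    assume "\<not> h \<bullet> x < h \<bullet> y"
    then have eq: "h \<bullet> y = h \<bullet> x"
      using le[OF y(1)] by simp
    have "closed_segment x y \<subseteq> frontier G"
    proof
      fix z assume z: "z \<in> closed_segment x y"
      then have zG: "z \<in> G"
        using G(2) x y by (meson convex_contains_segment subset_eq)
      have hz: "h \<bullet> z = h \<bullet> x"
        using z eq by (auto simp: in_segment inner_add_right simp flip: distrib_right)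
      have "z \<notin> interior G"
      proof
        assume "z \<in> interior G"
        then obtain e where e: "e > 0" "cball z e \<subseteq> G"
          by (meson mem_interior_cball)
        \<comment> \<open>A step of length \<open>e\<close> against \<open>h\<close> stays in
          \<open>G\<close> but would undercut the minimum.\<close>
        have "z - (e / norm h) *\<^sub>R h \<in> cball z e"
          using \<open>h \<noteq> 0\<close> e by (simp add: dist_norm)
        with e le have "h \<bullet> x \<le> h \<bullet> (z - (e / norm h) *\<^sub>R h)"
          by blast
        then have "e / norm h * (h \<bullet> h) \<le> 0"
          by (simp add: inner_diff_right hz)
        moreover have "e / norm h * (h \<bullet> h) > 0"
          using \<open>h \<noteq> 0\<close> e by simp
        ultimately show False by simp
      qed
      with zG show "z \<in> frontier G"
        using closure_subset by (auto simp: frontier_def)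
    qed
    with G(3) y(2) show False
      unfolding strictly_convex_def by metis
  qed
  with x that show thesis by blast
qed

text \<open>Danskin's theorem for a linear function with a unique minimizer on a compact set.\<close>

lemma min_inner_directional_derivative:
  fixes G :: "'b::euclidean_space set"
  assumes G: "compact G" and x0: "x0 \<in> G"
    and uniq: "\<And>y. y \<in> G \<Longrightarrow> y \<noteq> x0 \<Longrightarrow> h \<bullet> x0 < h \<bullet> y"
  shows "((\<lambda>\<epsilon>. (min_inner G (h + \<epsilon> *\<^sub>R v) - h \<bullet> x0) / \<epsilon>) \<longlongrightarrow> v \<bullet> x0) (at_right 0)"
proof -
  have bG: "bounded G" and ne: "G \<noteq> {}"
    using G x0 compact_imp_bounded by auto
  define q where "q \<epsilon> = (min_inner G (h + \<epsilon> *\<^sub>R v) - h \<bullet> x0) / \<epsilon>" for \<epsilon>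
  \<comment> \<open>\<open>x0\<close> competes in the perturbed minimum.\<close>
  have upper: "q \<epsilon> \<le> v \<bullet> x0" if "\<epsilon> > 0" for \<epsilon>
    using min_inner_le[OF bG x0, of "h + \<epsilon> *\<^sub>R v"] that
    by (simp add: q_def inner_add_left field_simps)
  have lower: "\<forall>\<^sub>F \<epsilon> in at_right 0. v \<bullet> x0 - \<eta> \<le> q \<epsilon>" if \<eta>: "\<eta> > 0" for \<eta>
  proof -
    \<comment> \<open>Only points of \<open>C\<close> could spoil the lower bound. \<open>C\<close>
      is compact and omits \<open>x0\<close>, so on it \<open>h\<close> exceeds its minimum by a
      fixed gap \<open>d\<close>.\<close>
    define C where "C = {x \<in> G. v \<bullet> x \<le> v \<bullet> x0 - \<eta>}"
    have C: "compact C"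
    proof -
      have "C = G \<inter> {x. v \<bullet> x \<le> v \<bullet> x0 - \<eta>}"
        by (auto simp: C_def)
      then show ?thesis
        using G closed_halfspace_le by (auto intro: compact_Int_closed)
    qed
    have "\<exists>d>0. \<forall>x\<in>C. h \<bullet> x0 + d \<le> h \<bullet> x"
    proof (cases "C = {}")
      case False
      then obtain c where c: "c \<in> C" "\<And>y. y \<in> C \<Longrightarrow> h \<bullet> c \<le> h \<bullet> y"
        using continuous_attains_inf[OF C _ continuous_on_inner[OF continuous_on_const continuous_on_id]]
      by blast
      have "c \<noteq> x0" "c \<in> G"
        using c(1) \<eta> by (auto simp: C_def)
      then have "h \<bullet> x0 < h \<bullet> c"
        by (intro uniq)
      with c show ?thesis
        by (intro exI[of _ "h \<bullet> c - h \<bullet> x0"]) auto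
    qed (auto intro: exI[of _ 1])
    then obtain d where d: "d > 0" "\<And>x. x \<in> C \<Longrightarrow> h \<bullet> x0 + d \<le> h \<bullet> x"
      by blast
    \<comment> \<open>\<open>b\<close> bounds the possible gain per unit of
      \<open>\<epsilon>\<close>, the added 1 keeping it positive. For
      \<open>\<epsilon> < d / b\<close> the gain cannot outweigh the gap.\<close>
    define b where "b = \<bar>v \<bullet> x0 - \<eta> - min_inner G v\<bar> + 1"
    have "v \<bullet> x0 - \<eta> \<le> q \<epsilon>" if \<epsilon>: "0 < \<epsilon>" "\<epsilon> < d / b" for \<epsilon>
    proof -
      obtain x where x: "x \<in> G" "min_inner G (h + \<epsilon> *\<^sub>R v) = (h + \<epsilon> *\<^sub>R v) \<bullet> x"
        using min_inner_attained[OF G ne] by metis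
      have "h \<bullet> x0 + \<epsilon> * (v \<bullet> x0 - \<eta>) \<le> h \<bullet> x + \<epsilon> * (v \<bullet> x)"
      proof (cases "x \<in> C")
        case True
        have "\<epsilon> * (v \<bullet> x0 - \<eta> - v \<bullet> x) \<le> \<epsilon> * b"
          using min_inner_le[OF bG x(1), of v] \<epsilon> by (intro mult_left_mono) (auto simp: b_def)
        also have "\<dots> \<le> d"
          using \<epsilon> by (simp add: b_def field_simps)
        finally show ?thesis
          using d(2)[OF True] by (simp add: algebra_simps)
      next
        case False
        then have "v \<bullet> x0 - \<eta> \<le> v \<bullet> x"
          using x by (auto simp: C_def)
        then have "\<epsilon> * (v \<bullet> x0 - \<eta>) \<le> \<epsilon> * (v \<bullet> x)"
          using \<epsilon> by (intro mult_left_mono) auto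
        moreover have "h \<bullet> x0 \<le> h \<bullet> x"
          using uniq[OF x(1)] by (cases "x = x0") auto
        ultimately show ?thesis by simp
      qed
      then show ?thesis
        using \<epsilon> x by (simp add: q_def inner_add_left field_simps)
    qed
    moreover have "d / b > 0"
      using d by (simp add: b_def)
    ultimately show ?thesis
      by (auto simp: eventually_at_right_field)
  qed
  show ?thesis
    unfolding q_def[symmetric]
  proof (rule order_tendstoI)
    fix a assume "a < v \<bullet> x0"
    then show "\<forall>\<^sub>F \<epsilon> in at_right 0. a < q \<epsilon>"
      using lower[of "(v \<bullet> x0 - a) / 2"] by (auto elim!: eventually_mono simp: field_simps)
  next
    fix a assume "v \<bullet> x0 < a"
    then show "\<forall>\<^sub>F \<epsilon> in at_right 0. q \<epsilon> < a"
      using upper le_less_trans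
      by (auto simp: eventually_at_right_field intro!: exI[of _ 1])
  qed
qed

section \<open>Expectation vectors, utilities and contributions of portfolios\<close>

locale portfolio_model = prob_space M
  for M :: "'a measure" +
  fixes D :: "'a measure set" and X :: "'n::finite \<Rightarrow> 'a \<Rightarrow> real"
  assumes ac: "D \<subseteq> ac_prob_measures M" and convD: "convex_measures M D" and M_in_D: "M \<in> D"
    and X_L1w: "\<And>i. X i \<in> L1w M D"
begin

lemma sets_D: "Q \<in> D \<Longrightarrow> sets Q = sets M"
  and prob_space_D: "Q \<in> D \<Longrightarrow> prob_space Q"
  using ac by (auto simp: ac_prob_measures_def)

lemma integrable_X: "Q \<in> D \<Longrightarrow> integrable Q (X i)"
  using L1w_integrable[OF X_L1w] sets_D by blast

lemma expect_vec_nth: "Q \<in> D \<Longrightarrow> expect_vec Q X $ i = integral\<^sup>L Q (X i)"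
  by (simp add: expect_vec_def expect_eq_integral integrable_X)

lemma expect_component:
  "Q \<in> D \<Longrightarrow> expect Q (component g X i) = ereal (g $ i * expect_vec Q X $ i)"
  unfolding component_def by (subst expect_eq_integral) (simp_all add: integrable_X expect_vec_nth)

lemma expect_portfolio: "Q \<in> D \<Longrightarrow> expect Q (portfolio g X) = ereal (g \<bullet> expect_vec Q X)"
  unfolding portfolio_def component_def
  by (subst expect_eq_integral) (simp_all add: integrable_X expect_vec_nth inner_vec_def)

text \<open>The two conditions in \<open>L1w\<close> bound each coordinate from below and above,
  uniformly over \<open>D\<close>.\<close>

lemma bounded_expect_vec: "bounded {expect_vec Q X | Q. Q \<in> D}"
proof -
  have lower: "\<exists>b. \<forall>Q\<in>D. b \<le> c * expect_vec Q X $ i"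
    if "utility D (\<lambda>\<omega>. c * X i \<omega>) > -\<infinity>" for i c
  proof -
    from that obtain b where b: "ereal b < utility D (\<lambda>\<omega>. c * X i \<omega>)"
      using ereal_dense2 by blast
    have "b \<le> c * expect_vec Q X $ i" if "Q \<in> D" for Q
    proof -
      have "ereal b < expect Q (\<lambda>\<omega>. c * X i \<omega>)"
        by (rule less_INF_D[OF b[unfolded utility_def] that])
      then show ?thesis
        using expect_component[OF that, of "\<chi> i. c" i] by (simp add: component_def)
    qed
    then show ?thesis by blast
  qed
  have "\<exists>b. \<forall>Q\<in>D. \<bar>expect_vec Q X $ i\<bar> \<le> b" for i
  proof -
    obtain b1 b2 where b: "\<And>Q. Q \<in> D \<Longrightarrow> b1 \<le> expect_vec Q X $ i"
      "\<And>Q. Q \<in> D \<Longrightarrow> b2 \<le> - expect_vec Q X $ i"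
      using lower[of 1 i] lower[of "-1" i] X_L1w[of i] unfolding L1w_def
      by simp metis
    have "\<bar>expect_vec Q X $ i\<bar> \<le> \<bar>b1\<bar> + \<bar>b2\<bar>" if "Q \<in> D" for Q
      using b[OF that] by linarith
    then show ?thesis by blast
  qed
  then obtain b where b: "\<And>i Q. Q \<in> D \<Longrightarrow> \<bar>expect_vec Q X $ i\<bar> \<le> b i"
    by metis
  have "norm (expect_vec Q X) \<le> (\<Sum>i\<in>UNIV. b i)" if "Q \<in> D" for Q
    using norm_le_l1_cart[of "expect_vec Q X"] sum_mono[of UNIV, OF b[OF that]]
    by (rule order_trans)
  then show ?thesis
    by (auto simp: bounded_iff)
qed

lemma convex_expect_vec: "convex {expect_vec Q X | Q. Q \<in> D}"
  unfolding convex_alt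
proof (intro ballI allI impI)
  fix x y :: "real ^ 'n" and t :: real
  assume "x \<in> {expect_vec Q X | Q. Q \<in> D}" "y \<in> {expect_vec Q X | Q. Q \<in> D}" "0 \<le> t \<and> t \<le> 1"
  then obtain Q1 Q2 where Q: "Q1 \<in> D" "Q2 \<in> D" "x = expect_vec Q1 X" "y = expect_vec Q2 X"
    and t: "0 \<le> t" "t \<le> 1"
    by blast
  have "t \<in> {0..1}"
    using t by simp
  then obtain Q where "Q \<in> D"
    and mix: "\<forall>A\<in>sets M. measure Q A = (1 - t) * measure Q1 A + t * measure Q2 A"
    using convD[unfolded convex_measures_def, rule_format, OF Q(1,2)] by blast
  have "integral\<^sup>L Q (X i) = (1 - t) * integral\<^sup>L Q1 (X i) + t * integral\<^sup>L Q2 (X i)" for i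
    using Q(1,2) \<open>Q \<in> D\<close> t mix
    by (intro integral_mixture) (simp_all add: sets_D prob_space_D integrable_X)
  then have "(1 - t) *\<^sub>R x + t *\<^sub>R y = expect_vec Q X"
    using Q \<open>Q \<in> D\<close> by (simp add: vec_eq_iff expect_vec_nth)
  with \<open>Q \<in> D\<close> show "(1 - t) *\<^sub>R x + t *\<^sub>R y \<in> {expect_vec Q X | Q. Q \<in> D}"
    by (intro CollectI exI[of _ Q] conjI)
qed

lemma compact_generator: "compact (generator D X)"
  unfolding generator_def by (rule compact_closure[THEN iffD2, OF bounded_expect_vec])

lemma convex_generator: "convex (generator D X)"
  unfolding generator_def by (rule convex_closure[OF convex_expect_vec])

text \<open>Expectation is linear in the weights. As \<open>D\<close> is nonempty and the values are
  bounded below, the extended infimum is the real one, which ignores the closure.\<close>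

lemma utility_portfolio: "utility D (portfolio g X) = ereal (min_inner (generator D X) g)"
proof -
  have ne: "{expect_vec Q X | Q. Q \<in> D} \<noteq> {}"
    using M_in_D by blast
  have im: "(\<lambda>x. g \<bullet> x) ` {expect_vec Q X | Q. Q \<in> D} = (\<lambda>Q. g \<bullet> expect_vec Q X) ` D"
    by auto
  have "utility D (portfolio g X) = (INF Q\<in>D. ereal (g \<bullet> expect_vec Q X))"
    by (simp add: utility_def expect_portfolio)
  also have "\<dots> = ereal (INF Q\<in>D. g \<bullet> expect_vec Q X)"
    using bdd_below_inner[OF bounded_expect_vec, of g] M_in_D
    by (subst ereal_Inf') (auto simp: im image_image)
  also have "\<dots> = ereal (min_inner (generator D X) g)"
    by (simp only: generator_def min_inner_closure[OF bounded_expect_vec ne] im)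
  finally show ?thesis .
qed

text \<open>Adding a multiple of one component moves the weights along a coordinate axis, so
  contributions become directional derivatives of \<open>min_inner\<close>.\<close>

lemma portfolio_add_component:
  "(\<lambda>\<omega>. portfolio h X \<omega> + \<epsilon> * component h X i \<omega>) = portfolio (h + \<epsilon> *\<^sub>R axis i (h $ i)) X"
proof
  fix \<omega>
  have "(\<Sum>j\<in>UNIV. axis i (h $ i) $ j * X j \<omega>) = h $ i * X i \<omega>"
    by (subst sum.remove[of _ i]) (auto simp: axis_def)
  then show "portfolio h X \<omega> + \<epsilon> * component h X i \<omega> = portfolio (h + \<epsilon> *\<^sub>R axis i (h $ i)) X \<omega>"
    by (simp add: portfolio_def component_def distrib_right sum.distrib mult.assoc
        flip: sum_distrib_left)
qed

lemma utility_contr_component: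
  assumes x: "x \<in> generator D X" "\<And>y. y \<in> generator D X \<Longrightarrow> y \<noteq> x \<Longrightarrow> h \<bullet> x < h \<bullet> y"
  shows "utility_contr D (component h X i) (portfolio h X) = ereal (h $ i * x $ i)"
proof -
  have min: "min_inner (generator D X) h = h \<bullet> x"
    using x min_inner_attained[OF compact_generator, of h]
      min_inner_le[OF compact_imp_bounded[OF compact_generator] x(1), of h]
    by (metis empty_iff less_le_not_le)
  have "((\<lambda>\<epsilon>. ereal ((min_inner (generator D X) (h + \<epsilon> *\<^sub>R axis i (h $ i)) - h \<bullet> x) / \<epsilon>))
      \<longlongrightarrow> ereal (axis i (h $ i) \<bullet> x)) (at_right 0)"
    by (intro tendsto_ereal min_inner_directional_derivative[OF compact_generator x])
  then show ?thesis
    unfolding utility_contr_def portfolio_add_component utility_portfolio min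
    by (intro tendsto_Lim) (simp_all add: inner_axis' mult.commute)
qed

text \<open>At weight 0 every point of the generator is a minimizer, so the derivative formula does
  not apply; but the difference quotient is constantly 0.\<close>

lemma utility_contr_zero: "utility_contr D (component 0 X i) (portfolio 0 X) = 0"
proof -
  have "{expect_vec Q X | Q. Q \<in> D} \<noteq> {}"
    using M_in_D by blast
  then have "generator D X \<noteq> {}"
    by (simp only: generator_def closure_eq_empty not_False_eq_True)
  then have "min_inner (generator D X) 0 = 0"
    by (simp add: min_inner_def)
  moreover have axis_0: "axis i (0 :: real) = 0"
    by simp
  ultimately show ?thesis
    unfolding utility_contr_def portfolio_add_component utility_portfolio
    by (intro tendsto_Lim) (simp_all add: axis_0)
qed

text \<open>Negative utility rules out the infinite case and makes the denominator a positive
  real.\<close>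

lemma RAROC_portfolio:
  assumes "min_inner (generator D X) g < 0"
  shows "RAROC M D (portfolio g X) =
    ereal (g \<bullet> expect_vec M X / - min_inner (generator D X) g)"
  using assms by (simp add: RAROC_def risk_def utility_portfolio expect_portfolio M_in_D)

lemma RAROC_portfolio_zero: "RAROC M D (portfolio 0 X) = 0"
  by (simp add: RAROC_def expect_portfolio M_in_D flip: zero_ereal_def)

end

section \<open>Negativity of the utility on the cone\<close>

text \<open>As \<open>G\<close> has interior points, 0 is even interior to \<open>G + dual_cone H\<close>, so a small negative
  multiple of \<open>g\<close> lies in this sum.\<close>

lemma min_inner_neg:
  assumes G: "compact G" "interior G \<noteq> {}"
    and 0: "0 \<in> rel_interior {x + y | x y. x \<in> G \<and> y \<in> dual_cone H}"
    and g: "g \<in> H" "g \<noteq> 0"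
  shows "min_inner G g < 0"
proof -
  define S where "S = {x + y | x y. x \<in> G \<and> y \<in> dual_cone H}"
  have "G \<subseteq> S"
    \<comment> \<open>The summand from \<open>dual_cone H\<close> is 0.\<close>
    by (force simp: S_def dual_cone_def)
  then have "interior S \<noteq> {}"
    using G interior_mono by blast
  then have "0 \<in> interior S"
    using 0 by (simp add: S_def rel_interior_nonempty_interior)
  then obtain e where e: "e > 0" "cball 0 e \<subseteq> S"
    by (meson mem_interior_cball)
  have "- (e / norm g) *\<^sub>R g \<in> cball 0 e"
    using g e by simp
  then obtain x y where xy: "x \<in> G" "y \<in> dual_cone H" "- (e / norm g) *\<^sub>R g = x + y"
    using e(2) unfolding S_def by blast
  have "g \<bullet> x + g \<bullet> y = - (e / norm g) * (g \<bullet> g)"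
    by (metis xy(3) inner_add_right inner_scaleR_right)
  moreover have "e / norm g * (g \<bullet> g) > 0"
    using g e by simp
  moreover have "g \<bullet> y \<ge> 0"
    using xy g by (auto simp: dual_cone_def)
  ultimately have "g \<bullet> x < 0"
    by linarith
  then show ?thesis
    using min_inner_le[OF compact_imp_bounded[OF G(1)] xy(1), of g] by linarith
qed

section \<open>Equal contributions and maximal RAROC\<close>

text \<open>Contributions of RAROC are defined only for nonzero risk contributions: the first
  implication requires this for every \<open>i\<close>, the second compares the indices where it
  holds. The sign condition on the expectation makes the common value nonnegative; a negative one
  would lose against the zero portfolio, whose RAROC is 0.\<close>

theorem theorem2p5:
  fixes M :: "'a measure" and D :: "'a measure set"
    and X :: "'n::finite \<Rightarrow> 'a \<Rightarrow> real" and H :: "(real ^ 'n) set" and h :: "real ^ 'n"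
  assumes "prob_space M"
    and "D \<subseteq> ac_prob_measures M" and "convex_measures M D" and "M \<in> D"
    and "\<And>i. X i \<in> L1w M D"
    and "convex_cone H" and "closed H"
    and "expect_vec M X \<noteq> 0"
    and "strictly_convex (generator D X)"
    and "0 \<in> rel_interior {x + y | x y. x \<in> generator D X \<and> y \<in> dual_cone H}"
  shows
    "(h \<in> H \<longrightarrow>
      (\<forall>i. risk_contr D (component h X i) (portfolio h X) \<noteq> 0) \<longrightarrow>
      (\<forall>i j. RAROC_contr M D (component h X i) (portfolio h X)
           = RAROC_contr M D (component h X j) (portfolio h X)) \<longrightarrow>
      expect M (portfolio h X) \<ge> 0 \<longrightarrow>
        is_arg_max (\<lambda>g. RAROC M D (portfolio g X)) (\<lambda>g. g \<in> H) h \<and>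
        (\<forall>i. RAROC_contr M D (component h X i) (portfolio h X)
           = (SUP g\<in>H. RAROC M D (portfolio g X)))) \<and>
     (h \<in> interior H \<longrightarrow>
      is_arg_max (\<lambda>g. RAROC M D (portfolio g X)) (\<lambda>g. g \<in> H) h \<longrightarrow>
        (\<forall>i j. risk_contr D (component h X i) (portfolio h X) \<noteq> 0 \<longrightarrow>
               risk_contr D (component h X j) (portfolio h X) \<noteq> 0 \<longrightarrow>
               RAROC_contr M D (component h X i) (portfolio h X)
             = RAROC_contr M D (component h X j) (portfolio h X)))"
proof -
  interpret portfolio_model M D X
    using assms by (auto simp: portfolio_model_def portfolio_model_axioms_def)
  let ?G = "generator D X" and ?E = "expect_vec M X"
  let ?R = "\<lambda>g. RAROC M D (portfolio g X)"
  have bG: "bounded ?G"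
    by (rule compact_imp_bounded[OF compact_generator])
  have neg: "min_inner ?G g < 0" if "g \<in> H" "g \<noteq> 0" for g
    using min_inner_neg[OF compact_generator _ assms(10) that] assms(9)
    by (simp add: strictly_convex_def)
  have zero_risk_contr: "h \<noteq> 0" if "risk_contr D (component h X i) (portfolio h X) \<noteq> 0" for i
    using that utility_contr_zero by (auto simp: risk_contr_def)
  have contr: "\<exists>x\<in>?G. min_inner ?G h = h \<bullet> x \<and>
      (\<forall>y\<in>?G. y \<noteq> x \<longrightarrow> h \<bullet> x < h \<bullet> y) \<and>
      (\<forall>i. risk_contr D (component h X i) (portfolio h X) = ereal (- (h $ i * x $ i)))"
    if h0: "h \<noteq> 0"
  proof -
    obtain x where "x \<in> ?G" "min_inner ?G h = h \<bullet> x" "\<And>y. y \<in> ?G \<Longrightarrow> y \<noteq> x \<Longrightarrow> h \<bullet> x < h \<bullet> y"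
      using strictly_convex_unique_min[OF compact_generator convex_generator assms(9) h0] by metis
    then show ?thesis
      by (intro bexI[of _ x]) (auto simp: risk_contr_def utility_contr_component)
  qed
  \<comment> \<open>A nonzero risk contribution forces \<open>h $ i\<close> to be nonzero, so this
    factor cancels.\<close>
  have RAROC_contr: "RAROC_contr M D (component h X i) (portfolio h X) = ereal (- (?E $ i / x $ i))"
    if "risk_contr D (component h X i) (portfolio h X) = ereal (- (h $ i * x $ i))"
      "risk_contr D (component h X i) (portfolio h X) \<noteq> 0" for i x
    using that by (simp add: RAROC_contr_def expect_component M_in_D)
  show ?thesis
  proof (intro conjI impI)
    assume h: "h \<in> H"
      and nz: "\<forall>i. risk_contr D (component h X i) (portfolio h X) \<noteq> 0"
      and eq: "\<forall>i j. RAROC_contr M D (component h X i) (portfolio h X)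
        = RAROC_contr M D (component h X j) (portfolio h X)"
      and nonneg: "expect M (portfolio h X) \<ge> 0"
    have h0: "h \<noteq> 0"
      using nz zero_risk_contr by blast
    then obtain x where x: "x \<in> ?G" "min_inner ?G h = h \<bullet> x"
      and rc: "\<And>i. risk_contr D (component h X i) (portfolio h X) = ereal (- (h $ i * x $ i))"
      using contr by metis
    obtain R where R: "\<And>i. RAROC_contr M D (component h X i) (portfolio h X) = ereal R"
      using eq RAROC_contr rc nz by metis
    have "?E $ i = - R * x $ i" for i
    proof -
      have "x $ i \<noteq> 0"
        using rc[of i] nz[rule_format, of i] by auto
      moreover have "- (?E $ i / x $ i) = R"
        using RAROC_contr[OF rc] nz R by (metis ereal.inject)
      ultimately show ?thesis
        by (auto simp: field_simps)
    qed
    then have E: "?E = - R *\<^sub>R x"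
      by (simp add: vec_eq_iff)
    have hx: "h \<bullet> x < 0"
      using neg[OF h h0] x by simp
    have Rh: "?R h = ereal R"
      using hx x(2) by (simp add: RAROC_portfolio E)
    have "R \<ge> 0"
      using nonneg hx by (simp add: expect_portfolio M_in_D E mult_le_0_iff)
    have le: "?R g \<le> ereal R" if g: "g \<in> H" for g
    proof (cases "g = 0")
      case True
      then show ?thesis
        using \<open>R \<ge> 0\<close> by (simp add: RAROC_portfolio_zero)
    next
      case False
      \<comment> \<open>The point \<open>x\<close> minimizes for \<open>h\<close>, but for
        \<open>g\<close> it still bounds the minimum from above; \<open>R \<ge> 0\<close> preserves
        the inequality.\<close>
      have "g \<bullet> ?E \<le> R * - min_inner ?G g"
        using mult_left_mono[OF min_inner_le[OF bG x(1), of g] \<open>R \<ge> 0\<close>] by (simp add: E)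
      then show ?thesis
        using neg[OF g False] by (simp add: RAROC_portfolio field_simps)
    qed
    show "is_arg_max ?R (\<lambda>g. g \<in> H) h"
      using h le Rh by (auto simp: is_arg_max_def not_less)
    have "(SUP g\<in>H. ?R g) = ereal R"
    proof (rule antisym)
      show "(SUP g\<in>H. ?R g) \<le> ereal R"
        by (rule SUP_least[OF le])
      show "ereal R \<le> (SUP g\<in>H. ?R g)"
        using SUP_upper[OF h, of ?R] Rh by simp
    qed
    then show "\<forall>i. RAROC_contr M D (component h X i) (portfolio h X) = (SUP g\<in>H. ?R g)"
      using R by simp
  next
    assume int: "h \<in> interior H" and max: "is_arg_max ?R (\<lambda>g. g \<in> H) h"
    have "RAROC_contr M D (component h X i) (portfolio h X)
        = RAROC_contr M D (component h X j) (portfolio h X)"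
      if nzi: "risk_contr D (component h X i) (portfolio h X) \<noteq> 0"
        and nzj: "risk_contr D (component h X j) (portfolio h X) \<noteq> 0" for i j
    proof -
      have h: "h \<in> H" and h0: "h \<noteq> 0"
        using int interior_subset zero_risk_contr[OF nzi] by auto
      obtain x where x: "x \<in> ?G" "min_inner ?G h = h \<bullet> x" "\<forall>y\<in>?G. y \<noteq> x \<longrightarrow> h \<bullet> x < h \<bullet> y"
        and rc: "\<And>i. risk_contr D (component h X i) (portfolio h X) = ereal (- (h $ i * x $ i))"
        using contr[OF h0] by metis
      have hx: "h \<bullet> x < 0"
        using neg[OF h h0] x by simp
      define R where "R = h \<bullet> ?E / - (h \<bullet> x)"
      have Rh: "?R h = ereal R" and hE: "h \<bullet> ?E = - R * (h \<bullet> x)"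
        using hx x(2) by (simp_all add: RAROC_portfolio R_def)
      \<comment> \<open>Clearing the positive denominator makes maximality linear in
        \<open>?E\<close>; by \<open>hE\<close>, equality holds at \<open>h\<close>.\<close>
      have le: "g \<bullet> ?E + R * min_inner ?G g \<le> 0" if "g \<in> H" "g \<noteq> 0" for g
      proof -
        have "?R g \<le> ereal R"
          using max that Rh by (auto simp: is_arg_max_def not_less)
        then show ?thesis
          using neg[OF that] by (simp add: RAROC_portfolio field_simps)
      qed
      \<comment> \<open>This is the derivative along \<open>v\<close> of the function in
        \<open>le\<close>, which has a local maximum at \<open>h\<close> because \<open>h\<close> is
        an inner point.\<close>
      have dir: "v \<bullet> ?E + R * (v \<bullet> x) \<le> 0" for v
      proof (rule tendsto_upperbound)
        show "((\<lambda>\<epsilon>. v \<bullet> ?E + R * ((min_inner ?G (h + \<epsilon> *\<^sub>R v) - h \<bullet> x) / \<epsilon>))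
            \<longlongrightarrow> v \<bullet> ?E + R * (v \<bullet> x)) (at_right 0)"
          using x by (intro tendsto_intros min_inner_directional_derivative[OF compact_generator]) auto
        have "((\<lambda>\<epsilon>. h + \<epsilon> *\<^sub>R v) \<longlongrightarrow> h + 0 *\<^sub>R v) (at_right 0)"
          by (intro tendsto_intros)
        \<comment> \<open>Removing 0 keeps the perturbed weights in the range of
          \<open>le\<close>.\<close>
        moreover have "open (interior H - {0})" "h + 0 *\<^sub>R v \<in> interior H - {0}"
          using int h0 by auto
        ultimately have "\<forall>\<^sub>F \<epsilon> in at_right 0. h + \<epsilon> *\<^sub>R v \<in> interior H - {0}"
          by (rule topological_tendstoD)
        moreover have "\<forall>\<^sub>F \<epsilon> in at_right (0::real). 0 < \<epsilon>"
          by (rule eventually_at_right_less)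
        ultimately show "\<forall>\<^sub>F \<epsilon> in at_right 0.
            v \<bullet> ?E + R * ((min_inner ?G (h + \<epsilon> *\<^sub>R v) - h \<bullet> x) / \<epsilon>) \<le> 0"
        proof eventually_elim
          case (elim \<epsilon>)
          then have "(h + \<epsilon> *\<^sub>R v) \<bullet> ?E + R * min_inner ?G (h + \<epsilon> *\<^sub>R v) \<le> 0"
            using interior_subset by (intro le) auto
          then have "\<epsilon> * (v \<bullet> ?E) + R * (min_inner ?G (h + \<epsilon> *\<^sub>R v) - h \<bullet> x) \<le> 0"
            by (simp add: inner_add_left hE algebra_simps)
          with elim show ?case
            by (simp add: field_simps)
        qed
      qed simp
      \<comment> \<open>Taking the gradient itself as direction bounds its squared norm by
        0.\<close>
      have "(?E + R *\<^sub>R x) \<bullet> (?E + R *\<^sub>R x) \<le> 0"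
        using dir[of "?E + R *\<^sub>R x"] by (simp add: inner_add_right)
      then have "?E + R *\<^sub>R x = 0"
        by (metis inner_eq_zero_iff inner_ge_zero order_antisym)
      then have E: "?E = - R *\<^sub>R x"
        by (simp add: eq_neg_iff_add_eq_0)
      have "RAROC_contr M D (component h X k) (portfolio h X) = ereal R"
        if "risk_contr D (component h X k) (portfolio h X) \<noteq> 0" for k
        using RAROC_contr[OF rc that] that rc[of k] by (simp add: E)
      with nzi nzj show ?thesis by simp
    qed
    then show "\<forall>i j. risk_contr D (component h X i) (portfolio h X) \<noteq> 0 \<longrightarrow>
        risk_contr D (component h X j) (portfolio h X) \<noteq> 0 \<longrightarrow>
        RAROC_contr M D (component h X i) (portfolio h X)
        = RAROC_contr M D (component h X j) (portfolio h X)"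
      by blast
  qed
qed

end
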